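(* Let $\beta=(1,\delta_1,1,\delta_2,\ldots,1,\delta_\ell)$ with $\delta_i$ positive integers, and let $\overline{F}(\beta)$ be the corresponding (narrow) circular fence. The map $\overline{\phi}$ defined below is a cardinality-preserving bijection from the set of lower order ideals of $\overline{F}(\beta)$ to the set of upper order ideals (filters) of $\overline{F}(\beta)$.
   Context: For a composition $\beta$ with an even number $2\ell$ of parts, summing to $n$, the fence $F(\beta)$ (obtained from chains $S_1,\dots,S_{2\ell}$ with $\#S_i=\beta_i+1$ by identifying maximal elements of $S_i,S_{i+1}$ for $i$ odd and minimal elements for $i$ even) has elements $x_1,\ldots,x_{n+1}$ from left to right; the circular fence $\overline{F}(\beta)$ is obtained by identifying $x_1$ and $x_{n+1}$. For $\beta=(1,\delta_1,\ldots,1,\delta_\ell)$, $\overline{F}(\beta)$ is the disjoint union of chains $D_1,\ldots,D_\ell$ (descending segments), $\#D_i=\delta_i+1$, with the additional cover relations that the minimum of $D_{i-1}$ is covered by the maximum of $D_i$ (indices mod $\ell$). Every lower order ideal is $\lfloor d\rfloor$, the union over $i$ of the $d_i$ smallest elements of $D_i$; every filter is $\lceil e\rceil$, the union of the $e_i$ largest elements of $D_i$. Define $\overline{\phi}(\lfloor d\rfloor)=\lceil e\rceil$ as follows. If all $d_i>0$, then $e=d$. Otherwise regard $d$ as a circular sequence (indices mod $\ell$, $d_\ell$ followed by $d_1$); a factor is a run of cyclically consecutive entries (viewed as a linear sequence), a block is a maximal factor of positive entries, the trailing ones $T$ of a block $B$ is its maximal (possibly empty) final segment consisting of ones, and $B'$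 is $B$ with $T$ removed. Then (P1) for each block with nonempty $T$, exchange $T$ with the entry $0$ cyclically immediately following it; (P2) for each block with $\#B'\ge2$, decrease the last entry of $B'$ by $1$ and increase the first entry of $B'$ by $1$; the result is $e$. *)

theory Defs
  imports Main
begin

(* The i-th chain of the fence (counting from 0), as the set of the indices k of its elements x_k;
   consecutive chains share one element. *)
definition segment :: "nat list \<Rightarrow> nat \<Rightarrow> nat set" where
  "segment \<beta> i = {1 + sum_list (take i \<beta>) .. 1 + sum_list (take (Suc i) \<beta>)}"

(* Elements x_1, ..., x_(n+1) from left to right; as the counting is from 0, the ascending chains
   are those with even index. *)
definition fence_chains :: "nat list \<Rightarrow> nat rel" where
  "fence_chains \<beta> = {(x, y). \<exists>i < length \<beta>. x \<in> segment \<beta> i \<and> y \<in> segment \<beta> i \<and>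
      (if even i then x \<le> y else y \<le> x)}"

definition fence :: "nat list \<Rightarrow> nat rel" where
  "fence \<beta> = (fence_chains \<beta>)\<^sup>+"

definition glue :: "nat list \<Rightarrow> nat \<Rightarrow> nat" where
  "glue \<beta> k = (if k = sum_list \<beta> + 1 then 1 else k)"

(* The order relation; the underlying set is its Field, {1..n}. *)
definition circular_fence :: "nat list \<Rightarrow> nat rel" where
  "circular_fence \<beta> = (map_prod (glue \<beta>) (glue \<beta>) ` fence \<beta>)\<^sup>+"

definition lower_ideals :: "'a rel \<Rightarrow> 'a set set" where
  "lower_ideals r = {I. I \<subseteq> Field r \<and> (\<forall>y\<in>I. \<forall>x. (x, y) \<in> r \<longrightarrow> x \<in> I)}"

definition upper_ideals :: "'a rel \<Rightarrow> 'a set set" where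
  "upper_ideals r = {U. U \<subseteq> Field r \<and> (\<forall>x\<in>U. \<forall>y. (x, y) \<in> r \<longrightarrow> y \<in> U)}"

definition smallest_elems :: "'a rel \<Rightarrow> 'a set \<Rightarrow> nat \<Rightarrow> 'a set" where
  "smallest_elems r C m = {x \<in> C. card {y \<in> C. (y, x) \<in> r \<and> y \<noteq> x} < m}"

definition largest_elems :: "'a rel \<Rightarrow> 'a set \<Rightarrow> nat \<Rightarrow> 'a set" where
  "largest_elems r C m = {x \<in> C. card {y \<in> C. (x, y) \<in> r \<and> y \<noteq> x} < m}"

definition narrow :: "nat list \<Rightarrow> nat list" where
  "narrow \<delta> = concat (map (\<lambda>a. [1, a]) \<delta>)"

definition descending_chain :: "nat list \<Rightarrow> nat \<Rightarrow> nat set" where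
  "descending_chain \<delta> i = glue (narrow \<delta>) ` segment (narrow \<delta>) (2 * i + 1)"

definition ideal_of :: "nat list \<Rightarrow> nat list \<Rightarrow> nat set" where
  "ideal_of \<delta> d = (\<Union>i < length \<delta>.
      smallest_elems (circular_fence (narrow \<delta>)) (descending_chain \<delta> i) (d ! i))"

definition filter_of :: "nat list \<Rightarrow> nat list \<Rightarrow> nat set" where
  "filter_of \<delta> e = (\<Union>i < length \<delta>.
      largest_elems (circular_fence (narrow \<delta>)) (descending_chain \<delta> i) (e ! i))"

definition factor :: "nat list \<Rightarrow> nat \<Rightarrow> nat \<Rightarrow> nat list" where
  "factor d s m = map (\<lambda>k. d ! ((s + k) mod length d)) [0..<m]"

(* Maximality of the factor of length m starting at index s: both its cyclic neighbours are 0.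
   Only used for d with some entry 0, where m < length d follows. *)
definition is_block :: "nat list \<Rightarrow> nat \<Rightarrow> nat \<Rightarrow> bool" where
  "is_block d s m \<longleftrightarrow> s < length d \<and> 0 < m \<and> (\<forall>a \<in> set (factor d s m). 0 < a) \<and>
     d ! ((s + m) mod length d) = 0 \<and> d ! ((s + length d - 1) mod length d) = 0"

definition trailing_ones :: "nat list \<Rightarrow> nat list" where
  "trailing_ones B = rev (takeWhile (\<lambda>a. a = 1) (rev B))"

definition remove_trailing_ones :: "nat list \<Rightarrow> nat list" where
  "remove_trailing_ones B = rev (dropWhile (\<lambda>a. a = 1) (rev B))"

definition shift_unit :: "nat list \<Rightarrow> nat list" where
  "shift_unit B = (if 2 \<le> length B
     then B[0 := B ! 0 + 1, length B - 1 := B ! (length B - 1) - 1] else B)"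

(* The word that replaces B 0 = B' T 0, where 0 is the entry following the block B:
   T and 0 are exchanged (P1), and B' is modified by (P2). *)
definition block_image :: "nat list \<Rightarrow> nat list" where
  "block_image B = shift_unit (remove_trailing_ones B) @ [0] @ trailing_ones B"

(* A block together with the 0 following it occupies positions disjoint from those of any other
   block, so the value v is unique; the entries at the remaining positions are 0 and are kept. *)
definition phi_seq :: "nat list \<Rightarrow> nat list" where
  "phi_seq d = (if \<forall>a \<in> set d. 0 < a then d else
     map (\<lambda>j. if \<exists>s m k. is_block d s m \<and> k \<le> m \<and> j = (s + k) mod length d
              then THE v. \<exists>s m k. is_block d s m \<and> k \<le> m \<and> j = (s + k) mod length d \<and>
                     v = block_image (factor d s m) ! k
              else d ! j) [0..<length d])"

(* The bound d ! i \<le> \<delta> ! i + 1, the size of the i-th chain, makes d unique. *)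
definition phi_bar :: "nat list \<Rightarrow> nat set \<Rightarrow> nat set" where
  "phi_bar \<delta> I = filter_of \<delta> (phi_seq (THE d. length d = length \<delta> \<and>
      (\<forall>i < length \<delta>. d ! i \<le> \<delta> ! i + 1) \<and> I = ideal_of \<delta> d))"

end

theory Submission
  imports Defs
begin

text \<open>
  In the coordinates \<open>d\<close>, \<open>e\<close>, an ideal is a vector with \<open>0 \<le> d\<^sub>i \<le> \<delta>\<^sub>i + 1\<close> in which
  \<open>d\<^sub>i = \<delta>\<^sub>i + 1\<close> forces \<open>d\<^sub>i\<^sub>-\<^sub>1 > 0\<close>, and a filter one in which \<open>e\<^sub>i = \<delta>\<^sub>i + 1\<close> forces
  \<open>e\<^sub>i\<^sub>+\<^sub>1 > 0\<close>. Taking complements shows that there are equally many of both, so it suffices that the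
  map sends ideal vectors injectively to filter vectors and preserves the sum.

  If \<open>d\<close> has a zero, call a position \<open>n\<close> a tail if a word \<open>1\<dots>10\<close> (possibly just \<open>0\<close>) starts at \<open>n\<close>.
  Then the two rules (P1) and (P2) amount to the local formula: \<open>e\<^sub>n = [d\<^sub>n\<^sub>-\<^sub>1 = 1]\<close> at a tail, and
  \<open>e\<^sub>n = d\<^sub>n + [n-1 is a tail] - [n+1 is a tail]\<close> elsewhere. The tails of \<open>d\<close> are exactly the positions
  where a word \<open>01\<dots>1\<close> of \<open>e\<close> ends, so \<open>e\<close> determines the tails, and then the formula gives back \<open>d\<close>.
\<close>

section \<open>The map on circular sequences\<close>

text \<open>Unrolling the circle over the integers lets both neighbours of every position be written
  \<open>n - 1\<close> and \<open>n + 1\<close>, with no wrap-around case.\<close>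

definition cyc :: "nat list \<Rightarrow> int \<Rightarrow> nat" where
  "cyc d n = d ! nat (n mod int (length d))"

text \<open>Being a least fixed point, a tail has to reach a zero after finitely many ones; a
  sequence consisting only of ones has no tail.\<close>

inductive tail :: "(int \<Rightarrow> nat) \<Rightarrow> int \<Rightarrow> bool" for f where
  tail_zero: "f n = 0 \<Longrightarrow> tail f n"
| tail_one: "f n = 1 \<Longrightarrow> tail f (n + 1) \<Longrightarrow> tail f n"

text \<open>The mirror image of \<open>tail\<close>, to be evaluated on the image sequence:
  exchanging T with the following 0 turns 1...10 into 01...1.\<close>

inductive head :: "(int \<Rightarrow> nat) \<Rightarrow> int \<Rightarrow> bool" for f where
  head_zero: "f n = 0 \<Longrightarrow> head f n"
| head_one: "f n = 1 \<Longrightarrow> head f (n - 1) \<Longrightarrow> head f n"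

text \<open>On tails the ones move one place to the right, which is (P1). A non-tail preceded by a
  tail is the first entry of some B', one followed by a tail is the last; if B' has length 1 the two
  corrections cancel, matching the condition in (P2).\<close>

definition cyc_phi :: "(int \<Rightarrow> nat) \<Rightarrow> int \<Rightarrow> nat" where
  "cyc_phi f n = (if tail f n then of_bool (f (n - 1) = 1)
     else f n + of_bool (tail f (n - 1)) - of_bool (tail f (n + 1)))"

lemma tail_iff: "tail f n \<longleftrightarrow> f n = 0 \<or> f n = 1 \<and> tail f (n + 1)"
  by (subst tail.simps) auto

lemma not_tail_pos: "\<not> tail f n \<Longrightarrow> 0 < f n"
  by (metis gr0I tail_zero)

text \<open>The last entry of B' can be decreased and stays positive; it also keeps the subtraction
  on naturals in \<open>cyc_phi\<close> from truncating.\<close>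

lemma not_tail_before_tail: "\<not> tail f n \<Longrightarrow> tail f (n + 1) \<Longrightarrow> 2 \<le> f n"
  by (metis One_nat_def Suc_leI le_neq_implies_less not_tail_pos numeral_2_eq_2 tail_one)

lemma tail_before_not_tail: "\<not> tail f n \<Longrightarrow> tail f (n - 1) \<Longrightarrow> f (n - 1) = 0"
  by (metis diff_add_cancel tail_iff)

lemma tail_after_one: "tail f n \<Longrightarrow> f (n - 1) = 1 \<Longrightarrow> tail f (n - 1)"
  by (simp add: tail_one)

lemma cyc_phi_not_tail_pos: "\<not> tail f n \<Longrightarrow> 0 < cyc_phi f n"
  using not_tail_pos[of f n] not_tail_before_tail[of f n]
  by (auto simp: cyc_phi_def)

text \<open>Off the tails the image is positive, so its zeros lie on tails. A one of the image right
  after a tail cannot lie off the tails either: such a position is increased, and its value is at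
  least 2 even if it is also decreased.\<close>

lemma head_cyc_phi_imp_tail: "head (cyc_phi f) n \<Longrightarrow> tail f n"
proof (induction rule: head.induct)
  case (head_zero n)
  then show ?case using cyc_phi_not_tail_pos[of f n] by fastforce
next
  case (head_one n)
  show ?case
  proof (rule ccontr)
    assume "\<not> tail f n"
    then show False
      using head_one not_tail_pos[of f n] not_tail_before_tail[of f n]
      by (cases "tail f (n + 1)") (auto simp: cyc_phi_def)
  qed
qed

text \<open>The second assumption bounds by \<open>k\<close> the run of ones of \<open>f\<close>
  just left of \<open>n\<close>. Each one in that run keeps its successor at image value 1 and is
  itself a tail; where the run stops, the image is 0.\<close>

lemma tail_imp_head_cyc_phi:
  assumes "tail f n" and "f (n - 1 - int k) \<noteq> 1"
  shows "head (cyc_phi f) n"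
  using assms
proof (induction k arbitrary: n)
  case 0
  then show ?case by (simp add: head_zero cyc_phi_def)
next
  case (Suc k)
  show ?case
  proof (cases "f (n - 1) = 1")
    case True
    have "head (cyc_phi f) (n - 1)"
      using Suc.IH[of "n - 1"] Suc.prems True tail_after_one[of f n]
      by (simp add: algebra_simps)
    moreover have "cyc_phi f n = 1" using True Suc.prems by (simp add: cyc_phi_def)
    ultimately show ?thesis by (rule head_one[rotated])
  next
    case False
    then show ?thesis using Suc.prems by (simp add: head_zero cyc_phi_def)
  qed
qed

text \<open>With the tails known, the formula can be solved for \<open>f\<close>. If
  \<open>n\<close> and \<open>n + 1\<close> are tails, the image at \<open>n + 1\<close> records
  whether \<open>f n\<close> is 1; if only \<open>n\<close> is, then \<open>f n\<close> is 0. Off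
  the tails the corrections are undone.\<close>

lemma cyc_phi_inj:
  assumes tails: "\<And>n. tail f n \<longleftrightarrow> tail g n" and eq: "cyc_phi f = cyc_phi g"
  shows "f = g"
proof
  fix n
  have eqn: "cyc_phi f m = cyc_phi g m" for m by (simp add: eq)
  show "f n = g n"
  proof (cases "tail f n")
    case True
    then have *: "f n = 0 \<or> f n = 1" "g n = 0 \<or> g n = 1"
      using tails tail_iff[of f n] tail_iff[of g n] by auto
    show ?thesis
    proof (cases "tail f (n + 1)")
      case t: True
      then show ?thesis using eqn[of "n + 1"] tails * by (auto simp: cyc_phi_def)
    next
      case False
      then show ?thesis using True tails tail_iff[of f n] tail_iff[of g n] by auto
    qed
  next
    case False
    then show ?thesis
      using eqn[of n] tails[of n] tails[of "n-1"] tails[of "n+1"]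
        not_tail_before_tail[of f n] not_tail_before_tail[of g n]
      by (cases "tail f (n + 1)") (auto simp: cyc_phi_def)
  qed
qed

text \<open>The difference is a telescoping flow: inside a tail the ones move one step to the right,
  outside a unit moves from the last entry of \<open>B'\<close> back to the first.\<close>

lemma cyc_phi_flow:
  fixes f :: "int \<Rightarrow> nat"
  defines "c \<equiv> \<lambda>n. if tail f n \<and> tail f (n + 1) then of_bool (f n = 1)
                   else if \<not> tail f n \<and> \<not> tail f (n + 1) then -1 else (0 :: int)"
  shows "int (cyc_phi f n) = int (f n) + c (n - 1) - c n"
proof (cases "tail f n")
  case True
  then show ?thesis
    using tail_iff[of f n] tail_after_one[of f n] by (auto simp: cyc_phi_def c_def)
next
  case False
  then show ?thesis
    using not_tail_before_tail[of f n] by (auto simp: cyc_phi_def c_def)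
qed

section \<open>Periodicity and sums over one period\<close>

lemma sum_cyclic_shift:
  fixes c :: "int \<Rightarrow> int"
  assumes "\<And>n. c (n + int l) = c n"
  shows "(\<Sum>i<l. c (int i - 1)) = (\<Sum>i<l. c (int i))"
proof (cases l)
  case (Suc k)
  have "(\<Sum>i<l. c (int i - 1)) = c (- 1) + (\<Sum>i<k. c (int i))"
    unfolding Suc sum.lessThan_Suc_shift by simp
  also have "c (- 1) = c (int k)"
    using assms[of "- 1"] Suc by simp
  finally show ?thesis by (simp add: Suc)
qed simp

lemma tail_periodic:
  assumes "\<And>n. f (n + l) = f n"
  shows "tail f (n + l) \<longleftrightarrow> tail f n"
proof -
  \<comment> \<open>One implication is proved for an arbitrary period \<open>k\<close>, so that it
    can be used both for \<open>l\<close> and for \<open>- l\<close>.\<close>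
  have shift: "tail f n \<Longrightarrow> tail f (n + k)" if "\<And>n. f (n + k) = f n" for n k
  proof (induction rule: tail.induct)
    case (tail_zero n)
    then show ?case using that[of n] by (simp add: tail.tail_zero)
  next
    case (tail_one n)
    then show ?case using that[of n] tail.tail_one[of f "n + k"] by (simp add: algebra_simps)
  qed
  have "f (n - l) = f n" for n using assms[of "n - l"] by simp
  then show ?thesis using shift[of l n] shift[of "- l" "n + l"] assms by auto
qed

lemma cyc_phi_periodic:
  assumes "\<And>n. f (n + l) = f n"
  shows "cyc_phi f (n + l) = cyc_phi f n"
  using tail_periodic[of f l n, OF assms] assms[of n] assms[of "n - 1"]
    tail_periodic[of f l "n - 1", OF assms] tail_periodic[of f l "n + 1", OF assms]
  by (simp add: cyc_phi_def algebra_simps)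

text \<open>Position \<open>n\<close> gains \<open>c (n - 1)\<close> and loses \<open>c n\<close>;
  since \<open>c\<close> is periodic, gains and losses have equal sums over a full turn.\<close>

lemma sum_cyc_phi:
  assumes "\<And>n. f (n + int l) = f n"
  shows "(\<Sum>i<l. cyc_phi f (int i)) = (\<Sum>i<l. f (int i))"
proof -
  define c where "c n = (if tail f n \<and> tail f (n + 1) then of_bool (f n = 1)
                   else if \<not> tail f n \<and> \<not> tail f (n + 1) then -1 else (0 :: int))" for n
  have "c (n + int l) = c n" for n
    using tail_periodic[of f "int l" n, OF assms] tail_periodic[of f "int l" "n + 1", OF assms]
      assms[of n] by (simp add: c_def algebra_simps)
  note c = sum_cyclic_shift[of c, OF this]
  have "int (cyc_phi f n) = int (f n) + c (n - 1) - c n" for n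
    using cyc_phi_flow[of f n] by (simp add: c_def)
  then have "int (\<Sum>i<l. cyc_phi f (int i)) = int (\<Sum>i<l. f (int i))"
    using c by (simp add: sum.distrib sum_subtractf)
  then show ?thesis by (simp only: of_nat_eq_iff)
qed

section \<open>Lists as periodic sequences; the block rules agree with the local formula\<close>

lemma cyc_nat: "i < length d \<Longrightarrow> cyc d (int i) = d ! i"
  by (simp add: cyc_def)

lemma cyc_of_nat: "cyc d (int i) = d ! (i mod length d)"
  by (simp add: cyc_def zmod_int[symmetric])

lemma cyc_periodic [simp]: "cyc d (n + int (length d)) = cyc d n"
  by (simp add: cyc_def)

lemma periodic_mod:
  fixes f :: "int \<Rightarrow> 'a"
  assumes "\<And>n. f (n + l) = f n"
  shows "f (n mod l) = f n"
proof -
  have a: "f (n + int k * l) = f n" for n k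
  proof (induction k)
    case (Suc k)
    then show ?case using assms[of "n + int k * l"] by (simp add: algebra_simps)
  qed simp
  have "f (n + k * l) = f n" for k
  proof (cases "0 \<le> k")
    case True
    then show ?thesis using a[of n "nat k"] by simp
  next
    case False
    then show ?thesis using a[of "n + k * l" "nat (- k)"] by simp
  qed
  from this[of "- (n div l)"] show ?thesis by (simp add: minus_div_mult_eq_mod)
qed

lemma cyc_eqI:
  assumes "length d > 0" and "\<And>n. g (n + int (length d)) = g n"
    and "\<And>i. i < length d \<Longrightarrow> d ! i = g (int i)"
  shows "cyc d = g"
proof
  fix n
  let ?l = "int (length d)"
  have "0 \<le> n mod ?l" "n mod ?l < ?l" using assms(1) by auto
  then have "cyc d n = g (n mod ?l)" unfolding cyc_def using assms(3)[of "nat (n mod ?l)"] by simp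
  also have "\<dots> = g n" by (rule periodic_mod) (rule assms(2))
  finally show "cyc d n = g n" .
qed

lemma cyc_pos: "\<forall>a\<in>set d. 0 < a \<Longrightarrow> d \<noteq> [] \<Longrightarrow> 0 < cyc d n"
  unfolding cyc_def by (metis length_greater_0_conv nat_less_iff nth_mem of_nat_0_less_iff
      pos_mod_bound pos_mod_sign)

text \<open>Here \<open>s\<close> is the start of a block of length \<open>m\<close>; the index
  \<open>k = m\<close> is the 0 following it, which the rewritten word includes.\<close>

lemma block_image_nth:
  fixes f :: "int \<Rightarrow> nat" and s :: int
  assumes before: "f (s - 1) = 0" and after: "f (s + int m) = 0"
    and pos: "\<And>k. k < m \<Longrightarrow> 0 < f (s + int k)" and "k \<le> m"
  shows "block_image (map (\<lambda>k. f (s + int k)) [0..<m]) ! k = cyc_phi f (s + int k)"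
proof -
  define B where "B = map (\<lambda>k. f (s + int k)) [0..<m]"
  \<comment> \<open>\<open>q\<close> is the length of T and \<open>p\<close> that of B'. Among the
    offsets 0 to \<open>m\<close>, the tails turn out to be exactly those from \<open>p\<close>
    on.\<close>
  define q where "q = length (takeWhile (\<lambda>a. a = 1) (rev B))"
  define p where "p = m - q"
  have lenB: "length B = m" by (simp add: B_def)
  have nthB: "B ! i = f (s + int i)" if "i < m" for i using that by (simp add: B_def)
  have "q \<le> m" unfolding q_def using length_takeWhile_le[of _ "rev B"] lenB by simp
  have "p \<le> m" by (simp add: p_def)
  have T: "trailing_ones B = drop p B"
    unfolding trailing_ones_def by (subst takeWhile_eq_take) (simp add: q_def p_def rev_take lenB)
  have R: "remove_trailing_ones B = take p B"
    unfolding remove_trailing_ones_def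
    by (subst dropWhile_eq_drop) (simp add: q_def p_def rev_drop lenB)
  have ones: "f (s + int i) = 1" if "p \<le> i" "i < m" for i
  proof -
    have "B ! i \<in> set (trailing_ones B)"
      unfolding T in_set_conv_nth using that lenB by (intro exI[of _ "i - p"]) simp
    then have "B ! i = 1" unfolding trailing_ones_def by (auto dest: set_takeWhileD)
    then show ?thesis using nthB that by simp
  qed
  have last: "f (s + int (p - 1)) \<noteq> 1" if "0 < p"
  proof -
    have "q < length (rev B)" using that \<open>q \<le> m\<close> lenB by (simp add: p_def)
    then have "rev B ! q \<noteq> 1" using nth_length_takeWhile[of "\<lambda>a. a = 1" "rev B"] q_def by simp
    then have "B ! (p - 1) \<noteq> 1" using \<open>q < length (rev B)\<close> lenB by (simp add: rev_nth p_def)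
    then show ?thesis using nthB[of "p - 1"] that \<open>p \<le> m\<close> by simp
  qed
  have tails: "tail f (s + int i)" if "p \<le> i" "i \<le> m" for i
    using \<open>i \<le> m\<close> \<open>p \<le> i\<close>
  proof (induction rule: inc_induct)
    case base
    then show ?case by (simp add: tail_zero after)
  next
    case (step i)
    then show ?case using ones[of i] tail_one[of f "s + int i"] by (simp add: algebra_simps)
  qed
  have not_tails: "\<not> tail f (s + int i)" if "i < p" for i
  proof -
    have "i \<le> p - 1" using that by simp
    then show ?thesis
    proof (induction rule: inc_induct)
      case base
      then show ?case using last pos[of "p - 1"] that \<open>p \<le> m\<close> tail_iff[of f "s + int (p - 1)"]
        by simp
    next
      case (step i)
      then show ?case using pos[of i] \<open>p \<le> m\<close> tail_iff[of f "s + int i"]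
        by (simp add: algebra_simps)
    qed
  qed
  have first: "tail f (s - 1)" using before by (simp add: tail_zero)
  have len: "length (shift_unit (take p B)) = p"
    using \<open>p \<le> m\<close> lenB by (simp add: shift_unit_def)
  \<comment> \<open>The three pieces of the rewritten word: the modified B', the 0 moved to the
    left, and the shifted T.\<close>
  consider "k < p" | "k = p" | "p < k" by linarith
  then have "block_image B ! k = cyc_phi f (s + int k)"
  proof cases
    case 1
    have prev: "tail f (s + int k - 1) \<longleftrightarrow> k = 0"
    proof (cases k)
      case 0 then show ?thesis using first by simp
    next
      case (Suc j) then show ?thesis using not_tails[of j] 1 by simp
    qed
    have nxt: "tail f (s + int k + 1) \<longleftrightarrow> k + 1 = p"
      using not_tails[of "k + 1"] tails[of "k + 1"] 1 \<open>p \<le> m\<close>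
      by (cases "k + 1 = p") (auto simp: algebra_simps)
    have "block_image B ! k = shift_unit (take p B) ! k"
      using 1 len by (simp add: block_image_def R nth_append)
    also have "\<dots> = f (s + int k) + of_bool (k = 0) - of_bool (k + 1 = p)"
      using 1 \<open>p \<le> m\<close> lenB nthB by (auto simp: shift_unit_def nth_list_update min_def)
    finally show ?thesis using not_tails[OF 1] prev nxt by (simp add: cyc_phi_def)
  next
    case 2
    \<comment> \<open>The predecessor is the last entry of B' or, if B' is empty, the 0 before the
      block.\<close>
    have "f (s + int k - 1) \<noteq> 1"
      using last before 2 by (cases p) auto
    then show ?thesis
      using 2 len tails[of k] \<open>p \<le> m\<close> by (simp add: block_image_def R nth_append cyc_phi_def)
  next
    case 3
    then have "block_image B ! k = drop p B ! (k - p - 1)"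
      using len by (simp add: block_image_def R T nth_append)
    also have "\<dots> = 1"
      using 3 \<open>k \<le> m\<close> lenB nthB[of "k - 1"] ones[of "k - 1"] by simp
    finally show ?thesis
      using 3 \<open>k \<le> m\<close> tails[of k] ones[of "k - 1"] by (simp add: cyc_phi_def of_nat_diff algebra_simps)
  qed
  then show ?thesis by (simp add: B_def)
qed

lemma is_block_cyc:
  assumes "is_block d s m"
  shows "cyc d (int s - 1) = 0" "cyc d (int s + int m) = 0"
    "\<And>k. k < m \<Longrightarrow> 0 < cyc d (int s + int k)"
    "factor d s m = map (\<lambda>k. cyc d (int s + int k)) [0..<m]"
proof -
  have s: "s < length d" using assms by (simp add: is_block_def)
  have "cyc d (int s - 1) = cyc d (int (s + length d - 1))"
    using cyc_periodic[of d "int s - 1"] s by (simp add: of_nat_diff algebra_simps)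
  also have "\<dots> = 0" unfolding cyc_of_nat using assms by (simp add: is_block_def)
  finally show "cyc d (int s - 1) = 0" .
  show "cyc d (int s + int m) = 0"
    using assms cyc_of_nat[of d "s + m"] by (simp add: is_block_def)
  show fac: "factor d s m = map (\<lambda>k. cyc d (int s + int k)) [0..<m]"
    using cyc_of_nat[of d "s + _"] by (simp add: factor_def)
  show "0 < cyc d (int s + int k)" if "k < m" for k
    using assms that unfolding is_block_def fac by simp
qed

text \<open>These are the positions inside a block or on the 0 following one. The block is found by
  going left from the position to the nearest zero \<open>z\<close> and then right from
  \<open>z + 1\<close> to the next zero.\<close>

lemma exists_block:
  assumes "0 \<in> set d" and "j < length d" and "0 < cyc d (int j) \<or> 0 < cyc d (int j - 1)"
  shows "\<exists>s m k. is_block d s m \<and> k \<le> m \<and> j = (s + k) mod length d"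
proof -
  define l where "l = length d"
  define f where "f i = d ! (i mod l)" for i
  obtain i where i: "i < l" "d ! i = 0" using assms(1) by (metis in_set_conv_nth l_def)
  \<comment> \<open>One extra turn guarantees a zero strictly left of \<open>J\<close> among the
    natural numbers, so that the greatest one exists.\<close>
  define J where "J = j + l"
  have "0 < l" using i by simp
  have fJ: "0 < f J \<or> 0 < f (J - 1)"
  proof -
    have "cyc d (int j - 1) = cyc d (int (J - 1))"
      using cyc_periodic[of d "int j - 1"] \<open>0 < l\<close>
      by (simp add: of_nat_diff J_def l_def Suc_le_eq algebra_simps)
    moreover have "cyc d (int j) = cyc d (int J)"
      using cyc_periodic[of d "int j"] by (simp add: J_def l_def)
    ultimately show ?thesis using assms(3) by (simp add: cyc_of_nat f_def l_def)
  qed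
  define z where "z = (GREATEST z. z < J \<and> f z = 0)"
  have "i < J \<and> f i = 0" using i by (simp add: J_def f_def)
  then have z: "z < J" "f z = 0" and zmax: "\<And>y. y < J \<Longrightarrow> f y = 0 \<Longrightarrow> y \<le> z"
    unfolding z_def
    using GreatestI_nat[of "\<lambda>z. z < J \<and> f z = 0" i J] Greatest_le_nat[of "\<lambda>z. z < J \<and> f z = 0" _ J]
    by (auto simp: less_imp_le)
  define m where "m = (LEAST m. f (z + 1 + m) = 0)"
  \<comment> \<open>A full turn after \<open>z\<close> the same zero recurs, so the
    \<open>LEAST\<close> is attained.\<close>
  have "f (z + 1 + (l - 1)) = 0" using z \<open>0 < l\<close> by (simp add: f_def)
  then have m: "f (z + 1 + m) = 0" and mmin: "\<And>k. k < m \<Longrightarrow> 0 < f (z + 1 + k)"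
    unfolding m_def by (auto intro: LeastI dest: not_less_Least)
  have Jm: "J \<le> z + 1 + m"
    using zmax[of "z + 1 + m"] m by fastforce
  have "0 < m"
  proof (rule ccontr)
    assume "\<not> 0 < m"
    then have "J = z + 1" using Jm z by simp
    then show False using fJ z m \<open>\<not> 0 < m\<close> by simp
  qed
  define s where "s = (z + 1) mod l"
  have fs: "d ! ((s + k) mod l) = f (z + 1 + k)" for k
    by (simp add: f_def s_def mod_simps)
  have prev: "(s + l - 1) mod l = z mod l"
  proof -
    have "(s + l - 1) mod l = (s + (l - 1)) mod l" using \<open>0 < l\<close> by simp
    also have "\<dots> = (z + 1 + (l - 1)) mod l" unfolding s_def by (rule mod_add_left_eq)
    also have "\<dots> = z mod l" using \<open>0 < l\<close> by simp
    finally show ?thesis .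
  qed
  have "is_block d s m"
    using \<open>0 < m\<close> \<open>0 < l\<close> m z mmin fs prev
    by (auto simp: is_block_def factor_def l_def[symmetric] f_def[symmetric] s_def)
  moreover have "j = (s + (J - (z + 1))) mod l"
  proof -
    have "(s + (J - (z + 1))) mod l = (z + 1 + (J - (z + 1))) mod l"
      unfolding s_def by (rule mod_add_left_eq)
    also have "z + 1 + (J - (z + 1)) = J" using z by simp
    also have "J mod l = j" using assms(2) by (simp add: J_def l_def)
    finally show ?thesis by simp
  qed
  moreover have "J - (z + 1) \<le> m" using Jm by simp
  ultimately show ?thesis unfolding l_def by blast
qed

lemma length_phi_seq [simp]: "length (phi_seq d) = length d"
  by (simp add: phi_seq_def)

lemma cyc_cyc_phi_periodic: "cyc_phi (cyc d) (n + int (length d)) = cyc_phi (cyc d) n"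
  by (rule cyc_phi_periodic) simp

text \<open>Every presentation of \<open>j\<close> by a block yields the same value of
  \<open>cyc_phi\<close>, so the \<open>THE\<close> is determined without comparing blocks. At the
  remaining positions the entry and its predecessor are 0, and both descriptions give 0.\<close>

lemma phi_seq_nth:
  assumes "0 \<in> set d" and j: "j < length d"
  shows "phi_seq d ! j = cyc_phi (cyc d) (int j)"
proof -
  have val: "block_image (factor d s m) ! k = cyc_phi (cyc d) (int j)"
    if "is_block d s m" "k \<le> m" "j = (s + k) mod length d" for s m k
  proof -
    have "block_image (factor d s m) ! k = cyc_phi (cyc d) (int s + int k)"
      unfolding is_block_cyc(4)[OF that(1)]
      by (rule block_image_nth) (use is_block_cyc[OF that(1)] that in auto)
    also have "\<dots> = cyc_phi (cyc d) ((int s + int k) mod int (length d))"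
      by (rule periodic_mod[symmetric]) (rule cyc_cyc_phi_periodic)
    finally show ?thesis using that(3) by (simp add: zmod_int)
  qed
  show ?thesis
  proof (cases "\<exists>s m k. is_block d s m \<and> k \<le> m \<and> j = (s + k) mod length d")
    case True
    then have "(THE v. \<exists>s m k. is_block d s m \<and> k \<le> m \<and> j = (s + k) mod length d \<and>
                     v = block_image (factor d s m) ! k) = cyc_phi (cyc d) (int j)"
      using val by (intro the_equality) metis+
    then show ?thesis using True j assms(1) unfolding phi_seq_def by auto
  next
    case False
    then have "cyc d (int j) = 0" "cyc d (int j - 1) = 0"
      using exists_block[OF assms] by (meson gr0I)+
    then have "cyc_phi (cyc d) (int j) = 0" "d ! j = 0"
      using j by (auto simp: cyc_phi_def tail_zero cyc_nat)
    then show ?thesis using False j assms(1) unfolding phi_seq_def by auto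
  qed
qed

section \<open>Injectivity, preservation of the sum, and bounds\<close>

lemma cyc_phi_seq:
  assumes "0 \<in> set d"
  shows "cyc (phi_seq d) = cyc_phi (cyc d)"
  by (rule cyc_eqI) (use assms phi_seq_nth cyc_cyc_phi_periodic in auto)

text \<open>Ends the run of ones to the left, as \<open>tail_imp_head_cyc_phi\<close>
  demands.\<close>

lemma cyc_zero_cofinal:
  assumes "0 \<in> set d"
  shows "\<exists>k. cyc d (n - int k) = 0"
proof -
  obtain i where i: "i < length d" "d ! i = 0" using assms by (metis in_set_conv_nth)
  let ?k = "(n - int i) mod int (length d)"
  have "cyc d (n - ?k) = cyc d ((n - ?k) mod int (length d))"
    by (simp add: cyc_def)
  also have "(n - ?k) mod int (length d) = int i mod int (length d)"
    by (simp add: mod_simps)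
  also have "cyc d \<dots> = 0" using i by (simp add: cyc_def)
  finally show ?thesis
    using i by (metis gr_implies_not0 nat_0_le of_nat_0_less_iff pos_mod_sign zero_less_iff_neq_zero)
qed

lemma tail_iff_head:
  assumes "0 \<in> set d"
  shows "tail (cyc d) n \<longleftrightarrow> head (cyc (phi_seq d)) n"
proof -
  obtain k where "cyc d (n - 1 - int k) = 0" using cyc_zero_cofinal[OF assms] by blast
  then show ?thesis
    using tail_imp_head_cyc_phi[of "cyc d" n k] head_cyc_phi_imp_tail cyc_phi_seq[OF assms] by auto
qed

lemma phi_seq_pos: "0 \<notin> set d \<Longrightarrow> phi_seq d = d"
  by (metis neq0_conv phi_seq_def)

lemma cyc_inj:
  assumes "length d = length d'" "cyc d = cyc d'"
  shows "d = d'"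
  using assms by (metis cyc_nat nth_equalityI)

text \<open>A zero of \<open>d\<close> is a tail, hence a head of the image, and a head run starts
  at a zero. So the image reveals which branch of \<open>phi_seq\<close> was taken.\<close>

lemma zero_in_phi_seq:
  assumes "0 \<in> set d"
  shows "0 \<in> set (phi_seq d)"
proof (rule ccontr)
  assume "0 \<notin> set (phi_seq d)"
  then have pos: "0 < cyc (phi_seq d) n" for n
    using assms length_phi_seq[of d] by (intro cyc_pos) (auto simp del: length_phi_seq intro: gr0I)
  obtain n where "cyc d n = 0" using cyc_zero_cofinal[OF assms] by blast
  then have "head (cyc (phi_seq d)) n" using tail_iff_head[OF assms] tail_zero by blast
  then show False by (induction rule: head.induct) (use pos less_irrefl in metis)+
qed

lemma phi_seq_inj:
  assumes "length d = length d'" "phi_seq d = phi_seq d'"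
  shows "d = d'"
proof (cases "0 \<in> set d")
  case True
  then have z': "0 \<in> set d'"
    using zero_in_phi_seq[OF True] assms phi_seq_pos[of d'] by metis
  have "cyc d = cyc d'"
    by (rule cyc_phi_inj)
      (use tail_iff_head[OF True] tail_iff_head[OF z'] assms cyc_phi_seq[OF True] cyc_phi_seq[OF z'] in auto)
  then show ?thesis using assms cyc_inj by blast
next
  case False
  then have "0 \<notin> set d'"
    using zero_in_phi_seq[of d'] assms phi_seq_pos[of d] by metis
  then show ?thesis using False assms by (simp add: phi_seq_pos)
qed

lemma sum_list_phi_seq: "sum_list (phi_seq d) = sum_list d"
proof (cases "0 \<in> set d")
  case True
  have "sum_list (phi_seq d) = (\<Sum>i<length d. cyc_phi (cyc d) (int i))"
    using phi_seq_nth[OF True] by (simp add: sum_list_sum_nth atLeast0LessThan)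
  also have "\<dots> = (\<Sum>i<length d. cyc d (int i))"
    by (rule sum_cyc_phi) simp
  also have "\<dots> = sum_list d"
    by (simp add: sum_list_sum_nth atLeast0LessThan cyc_nat)
  finally show ?thesis .
qed (simp add: phi_seq_pos)

text \<open>\<open>D\<close> plays the role of \<delta>. An entry is increased only after a 0, where
  the ideal condition excludes the value \<open>D n + 1\<close>. If the image reaches
  \<open>D n + 1\<close>, then \<open>n + 1\<close> is not a tail, since otherwise a unit would have
  been lost; hence the next image entry is positive.\<close>

lemma cyc_phi_bounds:
  assumes D: "0 < D n" and bound: "f n \<le> D n + 1"
    and ideal: "f n = D n + 1 \<Longrightarrow> 0 < f (n - 1)"
  shows "cyc_phi f n \<le> D n + 1" and "cyc_phi f n = D n + 1 \<Longrightarrow> 0 < cyc_phi f (n + 1)"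
proof -
  have "cyc_phi f n \<le> D n + 1 \<and> (cyc_phi f n = D n + 1 \<longrightarrow> \<not> tail f n \<and> \<not> tail f (n + 1))"
  proof (cases "tail f n")
    case True
    then show ?thesis using D by (simp add: cyc_phi_def)
  next
    case False
    have "tail f (n - 1) \<Longrightarrow> f n \<le> D n"
      using tail_before_not_tail[OF False] ideal bound by (cases "f n = D n + 1") auto
    then show ?thesis using False bound by (auto simp: cyc_phi_def)
  qed
  then show "cyc_phi f n \<le> D n + 1" "cyc_phi f n = D n + 1 \<Longrightarrow> 0 < cyc_phi f (n + 1)"
    using cyc_phi_not_tail_pos by auto
qed

section \<open>Coordinates for the circular fence\<close>

lemma fence_chainsI:
  "i < length \<beta> \<Longrightarrow> x \<in> segment \<beta> i \<Longrightarrow> y \<in> segment \<beta> i \<Longrightarrow>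
    (if even i then x \<le> y else y \<le> x) \<Longrightarrow> (x, y) \<in> fence_chains \<beta>"
  unfolding fence_chains_def by blast

text \<open>The \<open>i\<close>-th ascending step starts at position
  \<open>1 + offset \<delta> i\<close>, and the descending chain after it ends where the next step
  starts.\<close>

definition offset :: "nat list \<Rightarrow> nat \<Rightarrow> nat" where
  "offset \<delta> i = sum_list (take i \<delta>) + i"

lemma sum_list_take_narrow:
  assumes "i \<le> length \<delta>"
  shows "sum_list (take (2 * i) (narrow \<delta>)) = offset \<delta> i"
  using assms
proof (induction \<delta> arbitrary: i)
  case (Cons a \<delta>)
  then show ?case by (cases i) (auto simp: narrow_def offset_def)
qed (simp add: narrow_def offset_def)

lemma nth_narrow_even: "i < length \<delta> \<Longrightarrow> narrow \<delta> ! (2 * i) = 1"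
proof (induction \<delta> arbitrary: i)
  case (Cons a \<delta>)
  then show ?case by (cases i) (auto simp: narrow_def)
qed simp

lemma length_narrow [simp]: "length (narrow \<delta>) = 2 * length \<delta>"
  by (induction \<delta>) (auto simp: narrow_def)

lemma sum_list_narrow: "sum_list (narrow \<delta>) = offset \<delta> (length \<delta>)"
  using sum_list_take_narrow[of "length \<delta>" \<delta>] by simp

lemma offset_Suc: "i < length \<delta> \<Longrightarrow> offset \<delta> (Suc i) = offset \<delta> i + \<delta> ! i + 1"
  by (simp add: offset_def take_Suc_conv_app_nth)

lemma offset_0 [simp]: "offset \<delta> 0 = 0"
  by (simp add: offset_def)

lemma offset_mono: "i \<le> j \<Longrightarrow> j \<le> length \<delta> \<Longrightarrow> offset \<delta> i \<le> offset \<delta> j"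
proof (induction rule: dec_induct)
  case (step j)
  then show ?case by (simp add: offset_Suc)
qed simp

lemma segment_even:
  assumes "i < length \<delta>"
  shows "segment (narrow \<delta>) (2 * i) = {1 + offset \<delta> i, 2 + offset \<delta> i}"
proof -
  have "sum_list (take (Suc (2 * i)) (narrow \<delta>)) = offset \<delta> i + 1"
    using assms sum_list_take_narrow[of i \<delta>] nth_narrow_even[of i \<delta>]
    by (simp add: take_Suc_conv_app_nth)
  then show ?thesis using assms sum_list_take_narrow[of i \<delta>] by (auto simp: segment_def)
qed

lemma segment_odd:
  assumes "i < length \<delta>"
  shows "segment (narrow \<delta>) (2 * i + 1) = {2 + offset \<delta> i .. 1 + offset \<delta> (Suc i)}"
proof -
  have "sum_list (take (Suc (2 * i)) (narrow \<delta>)) = offset \<delta> i + 1"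
    using assms sum_list_take_narrow[of i \<delta>] nth_narrow_even[of i \<delta>]
    by (simp add: take_Suc_conv_app_nth)
  then show ?thesis using assms sum_list_take_narrow[of "Suc i" \<delta>] by (simp add: segment_def)
qed

section \<open>The order of the circular fence in chain coordinates\<close>

locale narrow_circular_fence =
  fixes \<delta> :: "nat list"
  assumes nonempty: "\<delta> \<noteq> []" and pos: "\<forall>a \<in> set \<delta>. 0 < a"
begin

abbreviation l :: nat where "l \<equiv> length \<delta>"

abbreviation r :: "nat rel" where "r \<equiv> circular_fence (narrow \<delta>)"

text \<open>The element of \<open>D\<^sub>i\<close> with exactly \<open>a\<close> elements of \<open>D\<^sub>i\<close> below it (chains counted from 0).\<close>

definition elem :: "nat \<Rightarrow> nat \<Rightarrow> nat" where
  "elem i a = glue (narrow \<delta>) (1 + offset \<delta> (Suc i) - a)"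

abbreviation nxt :: "nat \<Rightarrow> nat" where "nxt i \<equiv> Suc i mod l"

lemma l_pos: "0 < l" using nonempty by simp

lemma nxt_less: "nxt i < l" using l_pos by simp

lemma delta_pos: "i < l \<Longrightarrow> 0 < \<delta> ! i" using pos by simp

text \<open>Before gluing, the chains occupy disjoint intervals that cover the positions from 2 to
  n+1. Gluing only sends n+1 to 1, a position in none of them.\<close>

lemma elem_inj:
  assumes "i < l" "a \<le> \<delta> ! i" "j < l" "b \<le> \<delta> ! j" "elem i a = elem j b"
  shows "i = j \<and> a = b"
proof -
  have range: "offset \<delta> i + 2 \<le> 1 + offset \<delta> (Suc i) - a" "1 + offset \<delta> (Suc i) - a \<le> 1 + offset \<delta> (Suc i)"
    "offset \<delta> (Suc i) \<le> offset \<delta> l"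
    if "i < l" "a \<le> \<delta> ! i" for i a
    using that offset_Suc[of i \<delta>] offset_mono[of "Suc i" l \<delta>] by auto
  have eq: "1 + offset \<delta> (Suc i) - a = 1 + offset \<delta> (Suc j) - b"
    using assms range[of i a] range[of j b]
    by (auto simp: elem_def glue_def sum_list_narrow split: if_splits)
  have "i = j"
  proof (rule ccontr)
    assume "i \<noteq> j"
    then consider "Suc i \<le> j" | "Suc j \<le> i" by linarith
    then show False
      by cases (use eq range[of i a] range[of j b] assms offset_mono[of "Suc i" j \<delta>]
        offset_mono[of "Suc j" i \<delta>] in auto)
  qed
  then show ?thesis using eq assms offset_Suc[of i \<delta>] by auto
qed

lemma elem_max: "i < l \<Longrightarrow> elem i (\<delta> ! i) = glue (narrow \<delta>) (2 + offset \<delta> i)"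
  by (simp add: elem_def offset_Suc)

text \<open>For the last chain this is the gluing itself: its minimum x_(n+1) becomes x_1.\<close>

lemma elem_min: "i < l \<Longrightarrow> elem i 0 = glue (narrow \<delta>) (1 + offset \<delta> (nxt i))"
  using l_pos mod_less[of "Suc i" l]
  by (cases "Suc i = l") (auto simp: elem_def glue_def sum_list_narrow)

lemma segment_odd_elem:
  assumes "i < l"
  shows "segment (narrow \<delta>) (2 * i + 1) = (\<lambda>a. 1 + offset \<delta> (Suc i) - a) ` {..\<delta> ! i}"
proof (intro subset_antisym subsetI)
  fix x assume "x \<in> segment (narrow \<delta>) (2 * i + 1)"
  then show "x \<in> (\<lambda>a. 1 + offset \<delta> (Suc i) - a) ` {..\<delta> ! i}"
    using assms unfolding segment_odd[OF assms]
    by (intro image_eqI[of _ _ "1 + offset \<delta> (Suc i) - x"]) (auto simp: offset_Suc)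
qed (use assms in \<open>auto simp: segment_odd[OF assms, simplified] offset_Suc\<close>)

lemma descending_chain_elem:
  assumes "i < l"
  shows "descending_chain \<delta> i = elem i ` {..\<delta> ! i}"
  unfolding descending_chain_def segment_odd_elem[OF assms] by (auto simp: elem_def)

definition fence_order :: "nat rel" where
  "fence_order = {(elem i a, elem i b) | i a b. i < l \<and> a \<le> b \<and> b \<le> \<delta> ! i} \<union>
     {(elem i 0, elem (nxt i) (\<delta> ! nxt i)) | i. i < l}"

lemma fence_orderI:
  "i < l \<Longrightarrow> a \<le> b \<Longrightarrow> b \<le> \<delta> ! i \<Longrightarrow> (elem i a, elem i b) \<in> fence_order"
  "i < l \<Longrightarrow> (elem i 0, elem (nxt i) (\<delta> ! nxt i)) \<in> fence_order"
  by (auto simp: fence_order_def)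

lemma fence_orderE:
  assumes "(x, y) \<in> fence_order"
  obtains (chain) i a b where "x = elem i a" "y = elem i b" "i < l" "a \<le> b" "b \<le> \<delta> ! i"
  | (up) i where "x = elem i 0" "y = elem (nxt i) (\<delta> ! nxt i)" "i < l"
  using assms unfolding fence_order_def by blast

text \<open>A step from a minimum up to the next maximum extends only trivially: nothing else of its
  chain lies below a minimum, nor above a maximum. Two such steps never compose, because positivity
  of \<delta> separates the minimum of a chain from its maximum.\<close>

lemma trans_fence_order: "trans fence_order"
proof (rule transI)
  fix x y z assume xy: "(x, y) \<in> fence_order" and yz: "(y, z) \<in> fence_order"
  from xy show "(x, z) \<in> fence_order"
  proof (cases rule: fence_orderE)
    case c: (chain i a b)
    from yz show ?thesis
    proof (cases rule: fence_orderE)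
      case (chain j a' b')
      then show ?thesis using c elem_inj[of i b j a'] by (auto intro: fence_orderI)
    next
      case (up j)
      then show ?thesis using c elem_inj[of i b j 0] by (auto intro: fence_orderI)
    qed
  next
    case u: (up i)
    from yz show ?thesis
    proof (cases rule: fence_orderE)
      case (chain j a' b')
      then show ?thesis using u elem_inj[of "nxt i" "\<delta> ! nxt i" j a'] nxt_less
        by (auto intro: fence_orderI)
    next
      case (up j)
      then show ?thesis
        using u elem_inj[of "nxt i" "\<delta> ! nxt i" j 0] nxt_less[of i] delta_pos[of "nxt i"] by auto
    qed
  qed
qed

lemma prev_exists:
  assumes "i < l"
  shows "\<exists>j<l. nxt j = i"
proof (cases i)
  case 0
  then show ?thesis using l_pos by (intro exI[of _ "l - 1"]) simp
next
  case (Suc j)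
  then show ?thesis using assms by (intro exI[of _ j]) simp
qed

lemma glue_fence_chains:
  "map_prod (glue (narrow \<delta>)) (glue (narrow \<delta>)) ` fence_chains (narrow \<delta>) = fence_order"
proof (intro subset_antisym subsetI)
  let ?g = "glue (narrow \<delta>)"
  fix p assume "p \<in> map_prod ?g ?g ` fence_chains (narrow \<delta>)"
  then obtain x y k where p: "p = (?g x, ?g y)" and k: "k < 2 * l"
    "x \<in> segment (narrow \<delta>) k" "y \<in> segment (narrow \<delta>) k" "if even k then x \<le> y else y \<le> x"
    by (auto simp: fence_chains_def)
  show "p \<in> fence_order"
  proof (cases "even k")
    case True
    then obtain i where i: "k = 2 * i" by (auto elim: evenE)
    then have "i < l" using k by simp
    \<comment> \<open>The ascending step into the chain \<open>i\<close> starts at the minimum of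
      the cyclically preceding chain \<open>j\<close>.\<close>
    obtain j where j: "j < l" "nxt j = i" using prev_exists[OF \<open>i < l\<close>] by blast
    have "?g (1 + offset \<delta> i) = elem j 0" "?g (2 + offset \<delta> i) = elem i (\<delta> ! i)"
      using elem_min[OF j(1)] elem_max[OF \<open>i < l\<close>] j by auto
    moreover have "x = y \<or> x = 1 + offset \<delta> i \<and> y = 2 + offset \<delta> i"
      "x = 1 + offset \<delta> i \<or> x = 2 + offset \<delta> i"
      using k True unfolding i segment_even[OF \<open>i < l\<close>] by auto
    ultimately show ?thesis
      using fence_orderI(1)[of j 0 0] fence_orderI(1)[of i "\<delta> ! i" "\<delta> ! i"] fence_orderI(2)[of j]
        j \<open>i < l\<close> p by auto
  next
    case False
    then obtain i where i: "k = 2 * i + 1" by (auto elim: oddE)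
    then have "i < l" using k by simp
    have "x \<in> (\<lambda>a. 1 + offset \<delta> (Suc i) - a) ` {..\<delta> ! i}"
      "y \<in> (\<lambda>a. 1 + offset \<delta> (Suc i) - a) ` {..\<delta> ! i}"
      using k unfolding i segment_odd_elem[OF \<open>i < l\<close>] by auto
    then obtain a b where "a \<le> \<delta> ! i" "b \<le> \<delta> ! i" "x = 1 + offset \<delta> (Suc i) - a"
      "y = 1 + offset \<delta> (Suc i) - b" by auto
    moreover have "y \<le> x" using k False by simp
    ultimately show ?thesis
      using p fence_orderI(1)[of i a b] \<open>i < l\<close> offset_Suc[of i \<delta>] by (auto simp: elem_def)
  qed
next
  let ?g = "glue (narrow \<delta>)"
  fix p assume "p \<in> fence_order"
  then obtain u v where uv: "p = (u, v)" "(u, v) \<in> fence_order" by (cases p) auto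
  from uv(2) show "p \<in> map_prod ?g ?g ` fence_chains (narrow \<delta>)"
  proof (cases rule: fence_orderE)
    case (chain i a b)
    have "(1 + offset \<delta> (Suc i) - a, 1 + offset \<delta> (Suc i) - b) \<in> fence_chains (narrow \<delta>)"
      by (rule fence_chainsI[of "2 * i + 1"]) (use chain segment_odd_elem[of i] in simp_all)
    from imageI[OF this, of "map_prod ?g ?g"] show ?thesis
      using uv chain by (simp add: elem_def)
  next
    case (up i)
    have "(1 + offset \<delta> j, 2 + offset \<delta> j) \<in> fence_chains (narrow \<delta>)" if "j < l" for j
      by (rule fence_chainsI[of "2 * j"]) (use segment_even[OF that] that in simp_all)
    from imageI[OF this[OF nxt_less], of "map_prod ?g ?g"] show ?thesis
      using uv up by (simp add: elem_min elem_max[OF nxt_less[of i]])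
  qed
qed

text \<open>The glued generating pairs already form a transitive relation, so neither of the two
  transitive closures adds a pair.\<close>

lemma circular_fence_eq: "r = fence_order"
proof
  let ?g = "glue (narrow \<delta>)"
  have "(?g x, ?g y) \<in> fence_order" if "(x, y) \<in> fence (narrow \<delta>)" for x y
    using that unfolding fence_def
  proof (induction rule: trancl.induct)
    case (r_into_trancl x y)
    then show ?case unfolding glue_fence_chains[symmetric] by force
  next
    case (trancl_into_trancl x y z)
    have "(?g y, ?g z) \<in> fence_order"
      using trancl_into_trancl(2) unfolding glue_fence_chains[symmetric] by force
    then show ?case using trancl_into_trancl trans_fence_order by (meson transD)
  qed
  then have "map_prod ?g ?g ` fence (narrow \<delta>) \<subseteq> fence_order" by auto
  then have "r \<subseteq> fence_order\<^sup>+" unfolding circular_fence_def by (rule trancl_mono_subset)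
  then show "r \<subseteq> fence_order" by (simp add: trancl_id trans_fence_order)
  show "fence_order \<subseteq> r"
    unfolding glue_fence_chains[symmetric] circular_fence_def fence_def
    by (blast intro: r_into_trancl' image_mono[THEN subsetD])
qed

lemma elem_le_iff:
  assumes "i < l" "a \<le> \<delta> ! i" "b \<le> \<delta> ! i"
  shows "(elem i a, elem i b) \<in> r \<longleftrightarrow> a \<le> b"
proof
  assume "(elem i a, elem i b) \<in> r"
  then have "(elem i a, elem i b) \<in> fence_order" by (simp add: circular_fence_eq)
  then show "a \<le> b"
  proof (cases rule: fence_orderE)
    case (chain j a' b')
    then show ?thesis using assms elem_inj[of i a j a'] elem_inj[of i b j b'] by auto
  next
    \<comment> \<open>Such a step can stay within one chain, namely when there is only one; it still
      starts at the minimum, so \<open>a\<close> is 0.\<close>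
    case (up j)
    then show ?thesis using assms elem_inj[of i a j 0] by auto
  qed
qed (use assms in \<open>simp add: circular_fence_eq fence_orderI\<close>)

lemma Field_r: "Field r = {elem i a | i a. i < l \<and> a \<le> \<delta> ! i}"
proof (intro subset_antisym subsetI)
  fix x assume "x \<in> Field r"
  then consider y where "(x, y) \<in> fence_order" | y where "(y, x) \<in> fence_order"
    unfolding circular_fence_eq Field_def by blast
  then show "x \<in> {elem i a | i a. i < l \<and> a \<le> \<delta> ! i}"
    by cases (elim fence_orderE; use nxt_less in force)+
next
  fix x assume "x \<in> {elem i a | i a. i < l \<and> a \<le> \<delta> ! i}"
  then have "(x, x) \<in> r" by (auto simp: circular_fence_eq intro: fence_orderI)
  then show "x \<in> Field r" by (auto simp: Field_def)
qed

lemma elem_inj_on: "i < l \<Longrightarrow> inj_on (elem i) {..\<delta> ! i}"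
  by (auto simp: inj_on_def dest: elem_inj)

lemma smallest_elems_chain:
  assumes "i < l"
  shows "smallest_elems r (descending_chain \<delta> i) m = {elem i a | a. a \<le> \<delta> ! i \<and> a < m}"
proof -
  have "card {y \<in> descending_chain \<delta> i. (y, elem i a) \<in> r \<and> y \<noteq> elem i a} = a"
    if "a \<le> \<delta> ! i" for a
  proof -
    have "{y \<in> descending_chain \<delta> i. (y, elem i a) \<in> r \<and> y \<noteq> elem i a} = elem i ` {..<a}"
      unfolding descending_chain_elem[OF assms]
      using that elem_le_iff[OF assms] elem_inj[of i _ i a] assms by (auto simp: order.strict_iff_order)
    then show ?thesis
      using card_image[OF inj_on_subset[OF elem_inj_on[OF assms], of "{..<a}"]] that
      by (simp add: subset_eq)
  qed
  then show ?thesis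
    unfolding smallest_elems_def by (auto simp: descending_chain_elem[OF assms])
qed

lemma largest_elems_chain:
  assumes "i < l"
  shows "largest_elems r (descending_chain \<delta> i) m = {elem i a | a. a \<le> \<delta> ! i \<and> \<delta> ! i - a < m}"
proof -
  have "card {y \<in> descending_chain \<delta> i. (elem i a, y) \<in> r \<and> y \<noteq> elem i a} = \<delta> ! i - a"
    if "a \<le> \<delta> ! i" for a
  proof -
    have "{y \<in> descending_chain \<delta> i. (elem i a, y) \<in> r \<and> y \<noteq> elem i a} = elem i ` {a<..\<delta> ! i}"
      unfolding descending_chain_elem[OF assms]
      using that elem_le_iff[OF assms] elem_inj[of i _ i a] assms
      by (auto simp: image_iff order.strict_iff_order) metis
    then show ?thesis
      using card_image[OF inj_on_subset[OF elem_inj_on[OF assms], of "{a<..\<delta> ! i}"]]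
      by (simp add: subset_eq)
  qed
  then show ?thesis
    unfolding largest_elems_def by (auto simp: descending_chain_elem[OF assms])
qed

section \<open>Ideals and filters as vectors\<close>

lemma ideal_of_eq: "ideal_of \<delta> d = {elem i a | i a. i < l \<and> a \<le> \<delta> ! i \<and> a < d ! i}"
  unfolding ideal_of_def using smallest_elems_chain by auto

lemma filter_of_eq: "filter_of \<delta> e = {elem i a | i a. i < l \<and> a \<le> \<delta> ! i \<and> \<delta> ! i - a < e ! i}"
  unfolding filter_of_def using largest_elems_chain by auto

lemma elem_in_ideal_of:
  "i < l \<Longrightarrow> a \<le> \<delta> ! i \<Longrightarrow> elem i a \<in> ideal_of \<delta> d \<longleftrightarrow> a < d ! i"
  unfolding ideal_of_eq using elem_inj by blast

definition vectors :: "nat list set" where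
  "vectors = {d. length d = l \<and> (\<forall>i<l. d ! i \<le> \<delta> ! i + 1)}"

text \<open>A full chain contributes its maximum, which covers the minimum of the preceding chain;
  this is the only constraint between chains.\<close>

definition ideal_vectors :: "nat list set" where
  "ideal_vectors = {d \<in> vectors. \<forall>i<l. d ! nxt i = \<delta> ! nxt i + 1 \<longrightarrow> 0 < d ! i}"

definition filter_vectors :: "nat list set" where
  "filter_vectors = {e \<in> vectors. \<forall>i<l. e ! i = \<delta> ! i + 1 \<longrightarrow> 0 < e ! nxt i}"

lemma vectors_nth_le: "d \<in> vectors \<Longrightarrow> i < l \<Longrightarrow> d ! i \<le> \<delta> ! i + 1"
  by (simp add: vectors_def)

text \<open>Stated on all of \<open>vectors\<close> because the \<open>THE\<close> in
  \<open>phi_bar\<close> ranges over every bounded list.\<close>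

lemma ideal_of_inj: "inj_on (ideal_of \<delta>) vectors"
proof (rule inj_onI)
  fix d d' assume v: "d \<in> vectors" "d' \<in> vectors" and eq: "ideal_of \<delta> d = ideal_of \<delta> d'"
  have "d ! i = d' ! i" if "i < l" for i
  proof -
    have lt: "a < d ! i \<longleftrightarrow> a < d' ! i" if "a \<le> \<delta> ! i" for a
      using elem_in_ideal_of[of i a] \<open>i < l\<close> that eq by blast
    have "d ! i \<le> \<delta> ! i + 1" "d' ! i \<le> \<delta> ! i + 1"
      using v that by (auto simp: vectors_def)
    then show ?thesis
      using lt[of "d ! i"] lt[of "d' ! i"] by linarith
  qed
  then show "d = d'" using v by (auto simp: vectors_def intro: nth_equalityI)
qed

lemma ideal_of_lower_ideal:
  assumes "d \<in> ideal_vectors"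
  shows "ideal_of \<delta> d \<in> lower_ideals r"
proof -
  have "x \<in> ideal_of \<delta> d" if y: "y \<in> ideal_of \<delta> d" and "(x, y) \<in> r" for x y
  proof -
    have "(x, y) \<in> fence_order" using that by (simp add: circular_fence_eq)
    then show ?thesis
    proof (cases rule: fence_orderE)
      case (chain i a b)
      then show ?thesis using y elem_in_ideal_of[of i a] elem_in_ideal_of[of i b] by auto
    next
      case (up i)
      then have "\<delta> ! nxt i < d ! nxt i" using y elem_in_ideal_of nxt_less by auto
      moreover have "d ! nxt i \<le> \<delta> ! nxt i + 1"
        using assms nxt_less by (simp add: ideal_vectors_def vectors_def)
      ultimately have "0 < d ! i" using assms up(3) by (auto simp: ideal_vectors_def)
      then show ?thesis using up elem_in_ideal_of by simp
    qed
  qed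
  moreover have "ideal_of \<delta> d \<subseteq> Field r" unfolding Field_r ideal_of_eq by blast
  ultimately show ?thesis by (auto simp: lower_ideals_def)
qed

lemma lower_ideal_obtain:
  assumes "I \<in> lower_ideals r"
  obtains d where "d \<in> ideal_vectors" "I = ideal_of \<delta> d"
proof -
  \<comment> \<open>The first level of the chain missing from \<open>I\<close>. The disjunct on the
    left makes the \<open>LEAST\<close> exist and gives a full chain the value
    \<open>\<delta> ! i + 1\<close>.\<close>
  define h where "h i = (LEAST a. \<delta> ! i < a \<or> elem i a \<notin> I)" for i
  define d where "d = map h [0..<l]"
  have down: "(x, y) \<in> fence_order \<Longrightarrow> y \<in> I \<Longrightarrow> x \<in> I" for x y
    using assms by (auto simp: lower_ideals_def circular_fence_eq)
  have h_le: "h i \<le> \<delta> ! i + 1" for i unfolding h_def by (rule Least_le) simp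
  have h_prop: "\<delta> ! i < h i \<or> elem i (h i) \<notin> I" for i
    unfolding h_def by (rule LeastI[of _ "\<delta> ! i + 1"]) simp
  have h_in: "elem i a \<in> I \<longleftrightarrow> a < h i" if "i < l" "a \<le> \<delta> ! i" for i a
  proof
    assume "a < h i"
    then show "elem i a \<in> I" unfolding h_def using not_less_Least by blast
  next
    assume "elem i a \<in> I"
    then show "a < h i"
      using h_prop[of i] down[of "elem i (h i)" "elem i a"] fence_orderI(1)[of i "h i" a] that
      by (cases "a < h i") auto
  qed
  have "d \<in> ideal_vectors"
  proof -
    have "0 < h i" if "i < l" "h (nxt i) = \<delta> ! nxt i + 1" for i
      using that h_in[of "nxt i" "\<delta> ! nxt i"] h_in[of i 0] nxt_less
        down[OF fence_orderI(2)] by simp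
    then show ?thesis using h_le nxt_less by (auto simp: ideal_vectors_def vectors_def d_def)
  qed
  moreover have "I = ideal_of \<delta> d"
  proof -
    have "I \<subseteq> Field r" using assms by (simp add: lower_ideals_def)
    then have "I = {elem i a | i a. i < l \<and> a \<le> \<delta> ! i \<and> a < h i}"
      unfolding Field_r using h_in by blast
    moreover have "i < l \<and> a \<le> \<delta> ! i \<and> a < d ! i \<longleftrightarrow> i < l \<and> a \<le> \<delta> ! i \<and> a < h i" for i a
      by (auto simp: d_def)
    ultimately show ?thesis unfolding ideal_of_eq by simp
  qed
  ultimately show ?thesis by (rule that)
qed

lemma bij_ideal_of: "bij_betw (ideal_of \<delta>) ideal_vectors (lower_ideals r)"
proof (rule bij_betw_imageI)
  show "inj_on (ideal_of \<delta>) ideal_vectors"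
    by (rule inj_on_subset[OF ideal_of_inj]) (auto simp: ideal_vectors_def)
  show "ideal_of \<delta> ` ideal_vectors = lower_ideals r"
    using ideal_of_lower_ideal lower_ideal_obtain by blast
qed

section \<open>Filters by complementation\<close>

definition compl_vector :: "nat list \<Rightarrow> nat list" where
  "compl_vector d = map (\<lambda>i. \<delta> ! i + 1 - d ! i) [0..<l]"

lemma compl_vector_nth: "i < l \<Longrightarrow> compl_vector d ! i = \<delta> ! i + 1 - d ! i"
  by (simp add: compl_vector_def)

lemma compl_vector_vectors: "compl_vector d \<in> vectors"
  by (simp add: compl_vector_def vectors_def)

lemma compl_vector_involution:
  assumes "d \<in> vectors"
  shows "compl_vector (compl_vector d) = d"
  using assms by (auto simp: compl_vector_def vectors_def intro: nth_equalityI)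

text \<open>Complementation exchanges empty and full chains, so the filter condition becomes the
  contrapositive of the ideal condition.\<close>

lemma bij_compl_vector: "bij_betw compl_vector filter_vectors ideal_vectors"
proof (rule bij_betw_byWitness[of _ compl_vector])
  have "compl_vector d ! nxt i = \<delta> ! nxt i + 1 \<longleftrightarrow> d ! nxt i = 0"
    "0 < compl_vector d ! nxt i \<longleftrightarrow> d ! nxt i \<noteq> \<delta> ! nxt i + 1"
    "compl_vector d ! i = \<delta> ! i + 1 \<longleftrightarrow> d ! i = 0"
    "0 < compl_vector d ! i \<longleftrightarrow> d ! i \<noteq> \<delta> ! i + 1"
    if "d \<in> vectors" "i < l" for d i
    using that compl_vector_nth[OF nxt_less[of i], of d] compl_vector_nth[of i d]
      vectors_nth_le[OF _ nxt_less[of i], of d] vectors_nth_le[of d i] by auto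
  note compl_iffs = this
  show "compl_vector ` filter_vectors \<subseteq> ideal_vectors" "compl_vector ` ideal_vectors \<subseteq> filter_vectors"
    unfolding ideal_vectors_def filter_vectors_def
    using compl_iffs compl_vector_vectors by auto
qed (auto simp: compl_vector_involution filter_vectors_def ideal_vectors_def)

lemma filter_of_compl:
  assumes "e \<in> vectors"
  shows "filter_of \<delta> e = Field r - ideal_of \<delta> (compl_vector e)"
proof -
  have "\<delta> ! i - a < e ! i \<longleftrightarrow> elem i a \<notin> ideal_of \<delta> (compl_vector e)"
    if "i < l" "a \<le> \<delta> ! i" for i a
  proof -
    have "e ! i \<le> \<delta> ! i + 1" using assms that by (simp add: vectors_def)
    then show ?thesis using that elem_in_ideal_of by (auto simp: compl_vector_def)
  qed
  then show ?thesis unfolding filter_of_eq Field_r by blast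
qed

lemma bij_compl_ideals: "bij_betw (\<lambda>I. Field r - I) (lower_ideals r) (upper_ideals r)"
proof (rule bij_betw_byWitness[of _ "\<lambda>I. Field r - I"])
  show "(\<lambda>I. Field r - I) ` lower_ideals r \<subseteq> upper_ideals r"
    by (auto simp: lower_ideals_def upper_ideals_def intro: FieldI2)
  show "(\<lambda>I. Field r - I) ` upper_ideals r \<subseteq> lower_ideals r"
    by (auto simp: lower_ideals_def upper_ideals_def intro: FieldI1)
qed (auto simp: lower_ideals_def upper_ideals_def)

lemma bij_filter_of: "bij_betw (filter_of \<delta>) filter_vectors (upper_ideals r)"
proof -
  have "bij_betw ((\<lambda>I. Field r - I) \<circ> (ideal_of \<delta> \<circ> compl_vector)) filter_vectors (upper_ideals r)"
    by (rule bij_betw_trans[OF bij_betw_trans[OF bij_compl_vector bij_ideal_of] bij_compl_ideals])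
  then show ?thesis
    by (subst bij_betw_cong[where g = "(\<lambda>I. Field r - I) \<circ> (ideal_of \<delta> \<circ> compl_vector)"])
      (auto simp: filter_of_compl filter_vectors_def)
qed

section \<open>Cardinalities of ideals and filters\<close>

lemma card_chain_union:
  assumes "\<And>i. i < l \<Longrightarrow> A i \<subseteq> {..\<delta> ! i}"
  shows "card {elem i a | i a. i < l \<and> a \<in> A i} = (\<Sum>i<l. card (A i))"
proof -
  have fin: "finite (A i)" if "i < l" for i
    using assms[OF that] finite_subset by blast
  have "{elem i a | i a. i < l \<and> a \<in> A i} = (\<lambda>(i, a). elem i a) ` (SIGMA i:{..<l}. A i)"
    by auto
  moreover have "inj_on (\<lambda>(i, a). elem i a) (SIGMA i:{..<l}. A i)"
  proof (rule inj_onI, clarify)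
    fix i a j b assume "i < l" "a \<in> A i" "j < l" "b \<in> A j" "elem i a = elem j b"
    then show "i = j \<and> a = b" using assms[of i] assms[of j] elem_inj[of i a j b] by auto
  qed
  ultimately show ?thesis
    using fin by (simp add: card_image card_SigmaI)
qed

lemma card_ideal_of:
  assumes "d \<in> vectors"
  shows "card (ideal_of \<delta> d) = sum_list d"
proof -
  have "card {a. a \<le> \<delta> ! i \<and> a < d ! i} = d ! i" if "i < l" for i
  proof -
    have "{a. a \<le> \<delta> ! i \<and> a < d ! i} = {..<d ! i}"
      using assms that by (auto simp: vectors_def)
    then show ?thesis by simp
  qed
  then show ?thesis
    using card_chain_union[of "\<lambda>i. {a. a \<le> \<delta> ! i \<and> a < d ! i}"] assms
    by (auto simp: ideal_of_eq vectors_def sum_list_sum_nth atLeast0LessThan)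
qed

lemma card_filter_of:
  assumes "e \<in> vectors"
  shows "card (filter_of \<delta> e) = sum_list e"
proof -
  have "card {a. a \<le> \<delta> ! i \<and> \<delta> ! i - a < e ! i} = e ! i" if "i < l" for i
  proof -
    have "{a. a \<le> \<delta> ! i \<and> \<delta> ! i - a < e ! i} = {\<delta> ! i + 1 - e ! i..<\<delta> ! i + 1}"
      using assms that by (auto simp: vectors_def)
    then show ?thesis using assms that by (simp add: vectors_def)
  qed
  then show ?thesis
    using card_chain_union[of "\<lambda>i. {a. a \<le> \<delta> ! i \<and> \<delta> ! i - a < e ! i}"] assms
    by (auto simp: filter_of_eq vectors_def sum_list_sum_nth atLeast0LessThan)
qed

section \<open>Bijectivity of the map\<close>

lemma finite_vectors: "finite vectors"
proof (rule finite_subset)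
  show "vectors \<subseteq> {d. set d \<subseteq> {..sum_list \<delta> + 1} \<and> length d = l}"
  proof (intro subsetI CollectI conjI)
    fix d x assume d: "d \<in> vectors" and "x \<in> set d"
    then obtain i where "i < l" "x = d ! i" by (auto simp: vectors_def in_set_conv_nth)
    then show "x \<in> {..sum_list \<delta> + 1}"
      using vectors_nth_le[OF d, of i] elem_le_sum_list[of i \<delta>] by simp
  qed (simp add: vectors_def)
qed (simp add: finite_lists_length_eq)

lemma phi_seq_filter_vector:
  assumes d: "d \<in> ideal_vectors"
  shows "phi_seq d \<in> filter_vectors"
proof (cases "0 \<in> set d")
  case True
  have len: "length d = l" using d by (simp add: ideal_vectors_def vectors_def)
  have cyc_next: "cyc c (int i + 1) = c ! nxt i" if "length c = l" for c i
    using cyc_of_nat[of c "Suc i"] that by (simp add: add.commute)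
  have step: "cyc (phi_seq d) (int i) \<le> \<delta> ! i + 1 \<and>
      (cyc (phi_seq d) (int i) = \<delta> ! i + 1 \<longrightarrow> 0 < cyc (phi_seq d) (int i + 1))" if "i < l" for i
  proof -
    obtain j where j: "j < l" "nxt j = i" using prev_exists[OF \<open>i < l\<close>] by blast
    have prev: "cyc d (int i - 1) = d ! j"
    proof (cases "Suc j = l")
      \<comment> \<open>At the wrap-around, position -1 is read one period later, at
        \<open>l - 1\<close>.\<close>
      case True
      then have "i = 0" "int j = - 1 + int l" using j by auto
      then have "cyc d (int i - 1) = cyc d (int j)"
        using cyc_periodic[of d "- 1"] len by simp
      then show ?thesis using j len by (simp add: cyc_nat)
    next
      case False
      then have "i = Suc j" using j by simp
      then show ?thesis using j len by (simp add: cyc_nat)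
    qed
    have "cyc d (int i) \<le> cyc \<delta> (int i) + 1"
      "cyc d (int i) = cyc \<delta> (int i) + 1 \<Longrightarrow> 0 < cyc d (int i - 1)" "0 < cyc \<delta> (int i)"
      unfolding prev using d j \<open>i < l\<close> len delta_pos
      by (auto simp: ideal_vectors_def vectors_def cyc_nat)
    then show ?thesis
      using cyc_phi_bounds[of "cyc \<delta>" "int i" "cyc d"] cyc_phi_seq[OF True] \<open>i < l\<close>
      by (simp add: cyc_nat)
  qed
  show ?thesis
    using step cyc_next[of "phi_seq d"] len by (auto simp: filter_vectors_def vectors_def cyc_nat)
next
  case False
  then have "0 < d ! i" if "i < length d" for i
    using that by (metis gr0I nth_mem)
  then show ?thesis
    using d nxt_less False by (auto simp: phi_seq_pos filter_vectors_def ideal_vectors_def vectors_def)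
qed

text \<open>Surjectivity comes from counting: an injection into a finite set that complementation
  shows to be of equal size.\<close>

lemma bij_phi_seq: "bij_betw phi_seq ideal_vectors filter_vectors"
proof -
  have inj: "inj_on phi_seq ideal_vectors"
    by (rule inj_onI, rule phi_seq_inj) (auto simp: ideal_vectors_def vectors_def)
  have sub: "phi_seq ` ideal_vectors \<subseteq> filter_vectors"
    using phi_seq_filter_vector by blast
  have "finite filter_vectors"
    using finite_vectors by (simp add: filter_vectors_def)
  moreover have "card (phi_seq ` ideal_vectors) = card filter_vectors"
    using inj bij_betw_same_card[OF bij_compl_vector] by (simp add: card_image)
  ultimately have "phi_seq ` ideal_vectors = filter_vectors"
    using sub card_subset_eq by blast
  then show ?thesis using inj by (simp add: bij_betw_def)
qed

lemma phi_bar_ideal_of: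
  assumes "d \<in> ideal_vectors"
  shows "phi_bar \<delta> (ideal_of \<delta> d) = filter_of \<delta> (phi_seq d)"
proof -
  have v: "d \<in> vectors" using assms by (simp add: ideal_vectors_def)
  have "(THE d'. length d' = l \<and> (\<forall>i<l. d' ! i \<le> \<delta> ! i + 1) \<and> ideal_of \<delta> d = ideal_of \<delta> d') = d"
    by (rule the_equality) (use v ideal_of_inj in \<open>auto simp: vectors_def inj_on_def\<close>)
  then show ?thesis by (simp add: phi_bar_def)
qed

lemma phi_bar_bij: "bij_betw (phi_bar \<delta>) (lower_ideals r) (upper_ideals r)"
proof -
  have "bij_betw (phi_bar \<delta> \<circ> ideal_of \<delta>) ideal_vectors (upper_ideals r)"
    using bij_betw_trans[OF bij_phi_seq bij_filter_of]
    by (subst bij_betw_cong[where g = "filter_of \<delta> \<circ> phi_seq"]) (auto simp: phi_bar_ideal_of)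
  then show ?thesis using bij_betw_comp_iff[OF bij_ideal_of] by blast
qed

lemma card_phi_bar:
  assumes "I \<in> lower_ideals r"
  shows "card (phi_bar \<delta> I) = card I"
proof -
  obtain d where d: "d \<in> ideal_vectors" "I = ideal_of \<delta> d" using lower_ideal_obtain[OF assms] .
  then have "card (phi_bar \<delta> I) = sum_list (phi_seq d)"
    using phi_seq_filter_vector[OF d(1)] by (simp add: phi_bar_ideal_of card_filter_of filter_vectors_def)
  also have "\<dots> = card I"
    using d by (simp add: sum_list_phi_seq card_ideal_of ideal_vectors_def)
  finally show ?thesis .
qed

end

theorem theorem3p1:
  fixes \<delta> :: "nat list"
  assumes "\<delta> \<noteq> []"
    and "\<forall>a \<in> set \<delta>. 0 < a"
  shows "bij_betw (phi_bar \<delta>)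
           (lower_ideals (circular_fence (narrow \<delta>)))
           (upper_ideals (circular_fence (narrow \<delta>))) \<and>
         (\<forall>I \<in> lower_ideals (circular_fence (narrow \<delta>)). card (phi_bar \<delta> I) = card I)"
proof -
  interpret narrow_circular_fence \<delta> using assms by unfold_locales
  show ?thesis using phi_bar_bij card_phi_bar by blast
qed

end
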